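(* Let $k>0$. For $\lambda,\rho,v,c\in\mathbb{C}$ with $\Re\left(\frac{v}{k}\right)>-1$, $\Re(\lambda+\rho)>0$, $\Re\left(\lambda+\frac{v}{k}\right)>0$ and $z>0$ (where $z$ is the variable of integration), the following holds, $y$ being a parameter: $$\int_{0}^{1}z^{\lambda-1}(1-z)^{2(\lambda+\rho)-1}\left(1-\frac{z}{3}\right)^{2\lambda-1}\left(1-\frac{z}{4}\right)^{(\lambda+\rho)-1}W_{v,c}^{k}\left(\frac{yz\left(1-\frac{z}{3}\right)^2}{2}\right)dz$$ $$=\frac{\left(\frac{y}{2}\right)^{v/k}\,\Gamma(\lambda+\rho)\left(\frac{2}{3}\right)^{2(\lambda+\frac{v}{k})}}{k^{v/k}}\;{}_1\Psi_{2}\left[\begin{array}{c}\left(\lambda+\frac{v}{k},2\right)\\ \left(\frac{v}{k}+1,1\right),\ \left(2\lambda+\frac{v}{k}+\rho,2\right)\end{array};\ -\frac{4c\,y^2}{81k}\right].$$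
   Context: The $k$-gamma function is $\Gamma_k(s)=\int_0^\infty t^{s-1}e^{-t^k/k}\,dt$, and satisfies $\Gamma_k(s)=k^{\frac{s}{k}-1}\Gamma(s/k)$, where $\Gamma$ is the gamma function. The generalized $k$-Bessel function is given, for $k>0$, by $$W_{v,c}^{k}(x)=\sum_{n=0}^{\infty}\frac{(-c)^n}{\Gamma_k(nk+v+k)\,n!}\left(\frac{x}{2}\right)^{2n+\frac{v}{k}}.$$ The Wright-type hypergeometric function is $${}_1\Psi_2\left[\begin{array}{c}(\alpha_1,A_1)\\(\beta_1,B_1),(\beta_2,B_2)\end{array};x\right]=\sum_{n=0}^\infty\frac{\Gamma(\alpha_1+A_1n)}{\Gamma(\beta_1+B_1n)\Gamma(\beta_2+B_2n)}\frac{x^n}{n!}.$$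
   Formalization: The argument of W is taken to be yz(1−z/3)² instead of the printed yz(1−z/3)²/2; with the extra factor 1/2 the identity fails (e.g. c=0, k=v=λ=ρ=y=1, where the two sides differ by a factor 2), and the right-hand side is kept as printed. *)

theory Defs
  imports "HOL-Analysis.Analysis"
begin

text \<open>
  Complex power, principal branch.  It differs from the library's \<^term>\<open>(powr)\<close> only in the
  convention \<open>0\<^sup>0 = 1\<close> (the library has \<open>0 powr 0 = 0\<close>), which is the convention
  under which a power series is evaluated at its centre.  For \<open>x = 0\<close>, \<open>a \<noteq> 0\<close> the value is 0.
\<close>
definition cpow :: "complex \<Rightarrow> complex \<Rightarrow> complex" where
  "cpow x a = (if x = 0 \<and> a = 0 then 1 else x powr a)"

text \<open>The integral converges for \<open>k > 0\<close> and \<open>Re s > 0\<close>, the only range in which it is used.\<close>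
definition k_Gamma :: "real \<Rightarrow> complex \<Rightarrow> complex" where
  "k_Gamma k s =
     integral {0<..} (\<lambda>t::real. complex_of_real t powr (s - 1) * complex_of_real (exp (- (t powr k) / k)))"

definition k_Bessel :: "real \<Rightarrow> complex \<Rightarrow> complex \<Rightarrow> complex \<Rightarrow> complex" where
  "k_Bessel k v c x =
     (\<Sum>n. (- c) ^ n / (k_Gamma k (of_nat n * of_real k + v + of_real k) * fact n)
            * cpow (x / 2) (2 * of_nat n + v / of_real k))"

text \<open>
  Since \<^term>\<open>Gamma\<close> is 0 at its poles and division by 0 gives 0, the factors \<open>1 / \<Gamma>\<close> have the
  usual value 0 at nonpositive integers.
\<close>
definition Wright_1Psi2 ::
  "complex \<times> real \<Rightarrow> complex \<times> real \<Rightarrow> complex \<times> real \<Rightarrow> complex \<Rightarrow> complex" where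
  "Wright_1Psi2 = (\<lambda>(\<alpha>\<^sub>1, A\<^sub>1) (\<beta>\<^sub>1, B\<^sub>1) (\<beta>\<^sub>2, B\<^sub>2) x.
     \<Sum>n. Gamma (\<alpha>\<^sub>1 + of_real A\<^sub>1 * of_nat n)
           / (Gamma (\<beta>\<^sub>1 + of_real B\<^sub>1 * of_nat n) * Gamma (\<beta>\<^sub>2 + of_real B\<^sub>2 * of_nat n))
           * (x ^ n / fact n))"

end

theory Submission
  imports Defs
begin

text \<open>
  The substitution \<open>u = (9/4) z (1 - z/3)\<^sup>2\<close> maps \<open>(0, 1)\<close> onto itself with
  \<open>1 - u = (1 - z)\<^sup>2 (1 - z/4)\<close> and \<open>du/dz = (9/4) (1 - z/3) (1 - z)\<close>, so it turns Euler's Beta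
  integral into the Lavoie--Trottier integral.  The \<open>n\<close>-th term of the Bessel series shifts the
  parameter \<open>l + v/k\<close> of the latter by \<open>2n\<close>.  Since \<open>z (1 - z/3)\<^sup>2 \<le> 1\<close>, all partial sums are dominated
  by a multiple of the norm of the zeroth integrand, and the series may be integrated termwise.
\<close>

section \<open>Euler's Gamma and Beta integrals with complex parameters\<close>

lemma Gamma_nonzero_of_Re_pos: "Re z > 0 \<Longrightarrow> Gamma z \<noteq> 0"
  unfolding Gamma_eq_zero_iff by (auto elim!: nonpos_Ints_cases)

lemma borel_measurable_powr_of_pos_real [measurable]:
  "(\<lambda>t. indicator {0<..} t *\<^sub>R (complex_of_real t powr a)) \<in> borel_measurable borel"
  by (rule borel_measurable_continuous_on_indicator) (auto intro!: continuous_intros)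

text \<open>Recasts Euler's integral as a Lebesgue integral over the whole line with respect to
  \<open>lborel\<close>, the form to which Fubini applies.\<close>

lemma complex_Gamma_Bochner_integral:
  assumes "Re a > 0"
  shows "has_bochner_integral lborel
           (\<lambda>t. indicator {0<..} t *\<^sub>R (complex_of_real t powr (a - 1)) * of_real (exp (- t))) (Gamma a)"
proof -
  let ?f = "\<lambda>t. complex_of_real t powr (a - 1) / of_real (exp t)"
  have eq: "(\<lambda>t. indicator {0<..} t *\<^sub>R (complex_of_real t powr (a - 1)) * of_real (exp (- t))) =
            (\<lambda>t. indicator {0<..} t *\<^sub>R ?f t)"
    by (auto simp: fun_eq_iff indicator_def exp_minus field_simps)
  have meas: "(\<lambda>t. indicator {0<..} t *\<^sub>R ?f t) \<in> borel_measurable lborel"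
    unfolding eq [symmetric] by measurable
  have "integrable lebesgue (\<lambda>t. indicator {0<..} t *\<^sub>R ?f t)"
    using absolutely_integrable_Gamma_integral'[OF assms] by (simp add: set_integrable_def)
  \<comment> \<open>Borel measurability lets integrability descend from the completed measure to
    \<open>lborel\<close>.\<close>
  then have int: "integrable lborel (\<lambda>t. indicator {0<..} t *\<^sub>R ?f t)"
    by (subst (asm) integrable_completion) (simp_all only: meas)
  then have "(LINT t:{0<..}|lborel. ?f t) = integral {0<..} ?f"
    by (intro set_borel_integral_eq_integral) (simp add: set_integrable_def)
  also have "\<dots> = Gamma a"
    using Gamma_integral_complex'[OF assms] by (rule integral_unique)
  finally show ?thesis
    using int unfolding eq by (simp add: has_bochner_integral_iff set_lebesgue_integral_def)
qed

text \<open>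
  By Fubini, the convolution of \<open>t\<^sup>a\<^sup>-\<^sup>1 e\<^sup>-\<^sup>t\<close> and \<open>t\<^sup>b\<^sup>-\<^sup>1 e\<^sup>-\<^sup>t\<close> on the positive half-line has integral
  \<open>\<Gamma>(a) \<Gamma>(b)\<close>, and by scaling it equals \<open>B(a, b) u\<^sup>a\<^sup>+\<^sup>b\<^sup>-\<^sup>1 e\<^sup>-\<^sup>u\<close> at \<open>u\<close>.
\<close>
lemma complex_Beta_integral:
  assumes a: "Re a > 0" and b: "Re b > 0"
  defines "f \<equiv> \<lambda>t. complex_of_real t powr (a - 1) * of_real (1 - t) powr (b - 1)"
  shows "f absolutely_integrable_on {0<..<1}" and "integral {0<..<1} f = Beta a b"
proof -
  \<comment> \<open>Extending the power by zero to the whole line makes the integrands carry their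
    own range: \<open>P (a - 1) t * P (b - 1) (1 - t)\<close> lives on (0, 1).\<close>
  define P where "P = (\<lambda>a t. indicator {0<..} t *\<^sub>R (complex_of_real t powr a))"
  have [measurable]: "P c \<in> borel_measurable borel" for c
    unfolding P_def by (rule borel_measurable_powr_of_pos_real)
  have P_mult: "P c (u * t) = of_real u powr c * P c t" if "u > 0" for c u t
    using that by (auto simp: P_def indicator_def zero_less_mult_iff powr_times_real)
  define \<beta> where "\<beta> = (\<lambda>t. P (a - 1) t * P (b - 1) (1 - t))"
  have \<beta>_eq: "\<beta> = (\<lambda>t. indicator {0<..<1} t *\<^sub>R f t)"
    by (auto simp: \<beta>_def P_def f_def indicator_def fun_eq_iff)
  \<comment> \<open>On (0, 1) the norm of the complex integrand is the real Beta integrand with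
    parameters \<open>Re a\<close> and \<open>Re b\<close>.\<close>
  have "integrable lborel (\<lambda>t. indicator {0..1} t *\<^sub>R (t powr (Re a - 1) * (1 - t) powr (Re b - 1)))"
    using integrable_Beta[OF a b] by (simp add: set_integrable_def)
  then have int_\<beta>: "integrable lborel \<beta>"
  proof (rule Bochner_Integration.integrable_bound)
    show "\<beta> \<in> borel_measurable lborel"
      unfolding \<beta>_def by measurable
    show "AE t in lborel. norm (\<beta> t) \<le>
        norm (indicator {0..1} t *\<^sub>R (t powr (Re a - 1) * (1 - t) powr (Re b - 1)))"
      by (rule AE_I2)
         (auto simp: \<beta>_eq f_def indicator_def norm_mult norm_powr_real_powr simp del: of_real_diff)
  qed
  define B where "B = integral\<^sup>L lborel \<beta>"
  have int_f: "set_integrable lborel {0<..<1} f"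
    using int_\<beta> by (simp add: set_integrable_def \<beta>_eq)
  then show "f absolutely_integrable_on {0<..<1}"
    by (simp add: set_integrable_def integrable_completion)
  have B: "integral {0<..<1} f = B"
    using set_borel_integral_eq_integral(2)[OF int_f]
    by (simp add: set_lebesgue_integral_def B_def \<beta>_eq)

  define g where "g = (\<lambda>a t. P (a - 1) t * of_real (exp (- t)))"
  have [measurable]: "g c \<in> borel_measurable borel" for c
    unfolding g_def by measurable
  have g: "integrable lborel (g c)" "integral\<^sup>L lborel (g c) = Gamma c" if "Re c > 0" for c
    using complex_Gamma_Bochner_integral[OF that]
    by (simp_all add: g_def P_def has_bochner_integral_iff)
  have shift: "integral\<^sup>L lborel (\<lambda>u. h (u - t)) = integral\<^sup>L lborel h"
    for t and h :: "real \<Rightarrow> 'b :: {banach, second_countable_topology}"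
    by (subst lborel_integral_real_affine[of 1 _ t]) auto
  have int_conv: "integrable (lborel \<Otimes>\<^sub>M lborel) (\<lambda>(t, u). g a t * g b (u - t))"
  proof (rule lborel_pair.Fubini_integrable)
    show "(\<lambda>(t, u). g a t * g b (u - t)) \<in> borel_measurable (lborel \<Otimes>\<^sub>M lborel)"
      by measurable
    \<comment> \<open>By translation invariance the inner integral of the norm does not depend on
      \<open>t\<close>, so the outer one is a constant times the integral of
      \<open>norm (g a t)\<close>.\<close>
    have "(\<integral>u. norm (g b (u - t)) \<partial>lborel) = (\<integral>u. norm (g b u) \<partial>lborel)" for t
      using shift[of "\<lambda>u. norm (g b u)"] .
    then show "integrable lborel
        (\<lambda>t. \<integral>u. norm (case (t, u) of (t, u) \<Rightarrow> g a t * g b (u - t)) \<partial>lborel)"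
      by (simp add: norm_mult g a)
    have "integrable lborel (\<lambda>u. g b (u - t))" for t
      using lborel_integrable_real_affine_iff[of 1 "g b" "- t"] g(1)[OF b] by simp
    then show "AE t in lborel. integrable lborel (\<lambda>u. case (t, u) of (t, u) \<Rightarrow> g a t * g b (u - t))"
      by simp
  qed
  have conv: "(\<integral>t. g a t * g b (u - t) \<partial>lborel) = g (a + b) u * B" for u
  proof (cases "u > 0")
    case True
    \<comment> \<open>Rescale \<open>t\<close> to \<open>u * t\<close>. The exponents
      \<open>a - 1\<close> and \<open>b - 1\<close> of \<open>u\<close>, together with 1 from the
      Jacobian, add up to \<open>a + b - 1\<close>, while the two exponentials merge into
      exp(-u).\<close>
    have "g a (u * t) * g b (u - u * t) =
          of_real u powr (a - 1) * of_real u powr (b - 1) * of_real (exp (- u)) * \<beta> t" for t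
    proof -
      have "P (b - 1) (u - u * t) = of_real u powr (b - 1) * P (b - 1) (1 - t)"
        using P_mult[OF True, of "b - 1" "1 - t"] by (simp add: algebra_simps)
      moreover have "exp (- (u * t)) * exp (- (u - u * t)) = exp (- u)"
        by (simp flip: exp_add)
      then have "complex_of_real (exp (- (u * t))) * of_real (exp (- (u - u * t))) = of_real (exp (- u))"
        by (metis of_real_mult)
      ultimately show ?thesis
        unfolding g_def \<beta>_def P_mult[OF True] by (simp add: algebra_simps)
    qed
    then have "(\<integral>t. g a t * g b (u - t) \<partial>lborel) =
          of_real u * (of_real u powr (a - 1) * of_real u powr (b - 1) * of_real (exp (- u)) * B)"
      using True by (subst lborel_integral_real_affine[of u _ 0]) (auto simp: B_def scaleR_conv_of_real)
    also have "complex_of_real u * (of_real u powr (a - 1) * of_real u powr (b - 1)) =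
               of_real u powr (a + b - 1)"
      using True by (simp add: powr_add powr_diff)
    then have "of_real u * (of_real u powr (a - 1) * of_real u powr (b - 1) * of_real (exp (- u)) * B) =
               g (a + b) u * B"
      using True by (simp add: g_def P_def flip: mult.assoc)
    finally show ?thesis .
  next
    case False
    \<comment> \<open>For nonpositive \<open>u\<close>, the numbers \<open>t\<close> and
      \<open>u - t\<close> cannot both be positive.\<close>
    then have "g a t * g b (u - t) = 0" for t
      by (auto simp: g_def P_def indicator_def)
    then have "(\<integral>t. g a t * g b (u - t) \<partial>lborel) = 0"
      by (simp only: Bochner_Integration.integral_zero)
    with False show ?thesis
      by (simp add: g_def P_def)
  qed
  have "Gamma a * Gamma b = (\<integral>t. (\<integral>u. g a t * g b (u - t) \<partial>lborel) \<partial>lborel)"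
    by (simp add: shift g a b)
  also have "\<dots> = (\<integral>u. (\<integral>t. g a t * g b (u - t) \<partial>lborel) \<partial>lborel)"
    using lborel_pair.Fubini_integral[OF int_conv] by simp
  also have "\<dots> = Gamma (a + b) * B"
    using a b by (simp add: conv g)
  finally have "Gamma (a + b) * B = Gamma a * Gamma b" ..
  moreover have "Gamma (a + b) \<noteq> 0"
    using a b by (intro Gamma_nonzero_of_Re_pos) simp
  ultimately show "integral {0<..<1} f = Beta a b"
    unfolding B Beta_def by (simp add: field_simps)
qed

section \<open>The Lavoie-Trottier integral by change of variables\<close>

lemma of_real_powr_eq_exp:
  "x > 0 \<Longrightarrow> complex_of_real x powr a = exp (a * of_real (ln x))"
  by (simp add: powr_def Ln_of_real)

text \<open>The derivative is positive inside the interval but vanishes at 1, so strict monotonicity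
  up to the endpoints comes from its sign in the interior and continuity. Surjectivity is the
  intermediate value theorem.\<close>

lemma Lavoie_Trottier_substitution_range:
  defines "g \<equiv> \<lambda>x::real. 9 / 4 * (x * (1 - x / 3)\<^sup>2)"
  shows "inj_on g {0<..<1}" and "g ` {0<..<1} = {0<..<1}"
proof -
  have deriv: "(g has_real_derivative (9 / 4 * ((1 - x / 3) * (1 - x)))) (at x within S)" for x S
    unfolding g_def by (rule derivative_eq_intros refl | simp)+ (simp add: field_simps power2_eq_square)
  have cont: "continuous_on S g" for S
    using deriv by (rule DERIV_continuous_on)
  have less: "g x < g y" if "0 \<le> x" "x < y" "y \<le> 1" for x y
  proof (rule DERIV_pos_imp_increasing_open[OF \<open>x < y\<close> _ cont])
    fix u assume "x < u" "u < y"
    then have "9 / 4 * ((1 - u / 3) * (1 - u)) > 0"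
      using that by simp
    then show "\<exists>d. (g has_real_derivative d) (at u) \<and> d > 0"
      using deriv by blast
  qed
  show "inj_on g {0<..<1}"
  proof (rule inj_onI)
    fix x y assume "x \<in> {0<..<1}" "y \<in> {0<..<1}" "g x = g y"
    then show "x = y"
      using less[of x y] less[of y x] by (cases x y rule: linorder_cases) auto
  qed
  have [simp]: "g 0 = 0" "g 1 = 1"
    by (simp_all add: g_def power2_eq_square)
  show "g ` {0<..<1} = {0<..<1}"
  proof (intro equalityI subsetI)
    fix y assume "y \<in> g ` {0<..<1}"
    then obtain x where "0 < x" "x < 1" "y = g x"
      by auto
    then show "y \<in> {0<..<1}"
      using less[of 0 x] less[of x 1] by simp
  next
    fix y :: real assume y: "y \<in> {0<..<1}"
    then obtain x where "0 \<le> x" "x \<le> 1" "g x = y"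
      using IVT'[of g 0 y 1] cont by auto
    moreover from this y have "x \<noteq> 0" "x \<noteq> 1"
      by auto
    ultimately show "y \<in> g ` {0<..<1}"
      by force
  qed
qed

text \<open>The factor 1 - x/3 occurs squared in the new variable and once in its derivative, which
  gives the exponent 2(a - 1) + 1 = 2a - 1; likewise 1 - x occurs squared in the complement and once
  in the derivative. The constants collect to (9/4)^a, whose inverse is (2/3)^(2a).\<close>

lemma Lavoie_Trottier_integral:
  assumes a: "Re a > 0" and b: "Re b > 0"
  defines "f \<equiv> \<lambda>x. complex_of_real x powr (a - 1) * of_real (1 - x) powr (2 * b - 1)
                     * of_real (1 - x / 3) powr (2 * a - 1) * of_real (1 - x / 4) powr (b - 1)"
  shows "f absolutely_integrable_on {0<..<1}"
    and "integral {0<..<1} f = (2 / 3) powr (2 * a) * Beta a b"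
proof -
  define g where "g = (\<lambda>x::real. 9 / 4 * (x * (1 - x / 3)\<^sup>2))"
  define g' where "g' = (\<lambda>x::real. 9 / 4 * ((1 - x / 3) * (1 - x)))"
  define F where "F = (\<lambda>u. complex_of_real u powr (a - 1) * of_real (1 - u) powr (b - 1))"
  have deriv: "(g has_real_derivative g' x) (at x within {0<..<1})" for x
    unfolding g_def g'_def by (rule derivative_eq_intros refl | simp)+ (simp add: field_simps power2_eq_square)
  have f_eq: "f x = (2 / 3) powr (2 * a) * (\<bar>g' x\<bar> *\<^sub>R F (g x))" if x: "x \<in> {0<..<1}" for x
  proof -
    \<comment> \<open>All bases are positive, so each power is the exponential of a multiple of a
      real logarithm and the identity reduces to comparing exponents.\<close>
    have pos: "0 < x" "0 < 1 - x" "0 < 1 - x / 3" "0 < 1 - x / 4"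
      using x by auto
    have "9 / 4 = 1 / (2 / 3 :: real)\<^sup>2"
      by (simp add: power2_eq_square)
    then have ln94: "ln (9 / 4 :: real) = - 2 * ln (2 / 3)"
      by (simp only: ln_div ln_realpow) (simp add: ln_realpow)
    have g1: "1 - g x = (1 - x)\<^sup>2 * (1 - x / 4)"
      by (simp add: g_def field_simps power2_eq_square)
    have gpos: "g x > 0" "1 - g x > 0" "g' x > 0"
      using pos unfolding g1 by (simp_all add: g_def g'_def)
    have "ln (g x) = - 2 * ln (2 / 3) + ln x + 2 * ln (1 - x / 3)"
      using pos by (simp add: g_def ln_mult ln_realpow ln94 del: times_divide_eq_left)
    moreover have "ln (1 - g x) = 2 * ln (1 - x) + ln (1 - x / 4)"
      unfolding g1 using pos by (simp add: ln_mult ln_realpow)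
    moreover have "ln (g' x) = - 2 * ln (2 / 3) + ln (1 - x / 3) + ln (1 - x)"
      using pos by (simp add: g'_def ln_mult ln94 del: times_divide_eq_left)
    moreover have "complex_of_real (g' x) = exp (of_real (ln (g' x)))"
      using gpos by (simp flip: of_real_exp)
    moreover have "(2 / 3 :: complex) powr (2 * a) = exp (2 * a * of_real (ln (2 / 3)))"
      using of_real_powr_eq_exp[of "2 / 3" "2 * a"] by simp
    ultimately show ?thesis
      using gpos pos unfolding f_def F_def
      by (simp only: abs_of_pos scaleR_conv_of_real of_real_powr_eq_exp flip: exp_add)
         (simp add: algebra_simps)
  qed
  have "F absolutely_integrable_on g ` {0<..<1} \<and> integral (g ` {0<..<1}) F = Beta a b"
    using complex_Beta_integral[OF a b] Lavoie_Trottier_substitution_range(2)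
    by (simp add: F_def g_def)
  then have G: "(\<lambda>x. \<bar>g' x\<bar> *\<^sub>R F (g x)) absolutely_integrable_on {0<..<1}"
      "integral {0<..<1} (\<lambda>x. \<bar>g' x\<bar> *\<^sub>R F (g x)) = Beta a b"
    using has_absolute_integral_change_of_variables_real[of "{0<..<1}" g g' F "Beta a b"]
      deriv Lavoie_Trottier_substitution_range(1) by (auto simp: g_def)
  have "(\<lambda>x. (2 / 3) powr (2 * a) * (\<bar>g' x\<bar> *\<^sub>R F (g x))) absolutely_integrable_on {0<..<1}"
    using G(1) by (rule set_integrable_mult_right)
  then show "f absolutely_integrable_on {0<..<1}"
    by (rule absolutely_integrable_spike[where S = "{}"]) (auto simp: f_eq)
  have "integral {0<..<1} f = integral {0<..<1} (\<lambda>x. (2 / 3) powr (2 * a) * (\<bar>g' x\<bar> *\<^sub>R F (g x)))"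
    by (rule integral_cong) (rule f_eq)
  also have "\<dots> = (2 / 3) powr (2 * a) * Beta a b"
    by (simp only: integral_mult_right G)
  finally show "integral {0<..<1} f = (2 / 3) powr (2 * a) * Beta a b" .
qed

section \<open>The k-gamma function as a rescaled Gamma function\<close>

lemma k_Gamma_eq_Gamma:
  assumes k: "k > 0" and s: "Re s > 0"
  shows "k_Gamma k s = of_real k powr (s / of_real k - 1) * Gamma (s / of_real k)"
proof -
  define a where "a = s / of_real k"
  have a: "Re a > 0" and s_eq: "s = of_real k * a"
    using assms by (simp_all add: a_def)
  \<comment> \<open>The substitution u = t^k / k has inverse t = (k u)^(1/k) and turns exp(-t^k / k)
    into exp(-u). With s = k a, the remaining power is t^(s-1) = k^(a-1) u^(a-1) t^(k-1), whose last
    factor is du/dt.\<close>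
  define g where "g = (\<lambda>t. t powr k / k)"
  define g' where "g' = (\<lambda>t. t powr (k - 1))"
  define F where "F = (\<lambda>u. complex_of_real u powr (a - 1) / of_real (exp u))"
  have deriv: "(g has_real_derivative g' t) (at t within {0<..})" if "t \<in> {0<..}" for t
    unfolding g_def g'_def using that k by (auto intro!: derivative_eq_intros)
  have inj: "inj_on g {0<..}"
    using k by (intro inj_on_inverseI[where g = "\<lambda>u. (k * u) powr (1 / k)"]) (simp add: g_def powr_powr)
  have img: "g ` {0<..} = {0<..}"
  proof (intro equalityI subsetI)
    fix u :: real assume u: "u \<in> {0<..}"
    then have "u = g ((k * u) powr (1 / k))"
      using k by (simp add: g_def powr_powr)
    then show "u \<in> g ` {0<..}"
      using u k by (intro image_eqI[of _ g "(k * u) powr (1 / k)"]) auto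
  qed (use k in \<open>auto simp: g_def\<close>)
  have eq: "of_real t powr (s - 1) * of_real (exp (- (t powr k) / k)) =
            of_real k powr (a - 1) * (\<bar>g' t\<bar> *\<^sub>R F (g t))" if t: "t \<in> {0<..}" for t
  proof -
    have "ln (g t) = k * ln t - ln k" "g t > 0"
      using t k by (simp_all add: g_def ln_div ln_powr)
    moreover have "complex_of_real (g' t) = exp ((of_real k - 1) * of_real (ln t))"
      using t by (simp add: g'_def powr_def exp_of_real [symmetric])
    ultimately have "of_real t powr (s - 1) =
        of_real k powr (a - 1) * of_real (g' t) * of_real (g t) powr (a - 1)"
      using t k by (simp only: s_eq of_real_powr_eq_exp greaterThan_iff flip: exp_add)
        (simp add: algebra_simps)
    moreover have "F (g t) = of_real (g t) powr (a - 1) * of_real (exp (- (t powr k) / k))"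
      by (simp add: F_def g_def exp_minus divide_inverse)
    ultimately show ?thesis
      using t by (simp add: g'_def scaleR_conv_of_real)
  qed
  have "F absolutely_integrable_on g ` {0<..} \<and> integral (g ` {0<..}) F = Gamma a"
    unfolding img F_def
    using absolutely_integrable_Gamma_integral'[OF a] Gamma_integral_complex'[OF a]
    by (auto intro: integral_unique)
  then have G: "(\<lambda>x. \<bar>g' x\<bar> *\<^sub>R F (g x)) absolutely_integrable_on {0<..}"
      "integral {0<..} (\<lambda>x. \<bar>g' x\<bar> *\<^sub>R F (g x)) = Gamma a"
    using has_absolute_integral_change_of_variables_real[of "{0<..}" g g' F "Gamma a"]
      deriv inj by auto
  have "k_Gamma k s = integral {0<..} (\<lambda>t. of_real k powr (a - 1) * (\<bar>g' t\<bar> *\<^sub>R F (g t)))"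
    unfolding k_Gamma_def by (rule integral_cong) (rule eq)
  then show ?thesis
    by (simp only: integral_mult_right G a_def[symmetric])
qed

section \<open>Termwise integration by dominated convergence\<close>

lemma sums_integral_power_series:
  fixes f q :: "real \<Rightarrow> complex" and d :: "nat \<Rightarrow> complex"
  assumes int: "\<And>n. (\<lambda>x. f x * q x ^ n) absolutely_integrable_on S"
    and q: "\<And>x. x \<in> S \<Longrightarrow> norm (q x) \<le> 1"
    and d: "summable (\<lambda>n. norm (d n))"
  shows "(\<lambda>x. f x * (\<Sum>n. d n * q x ^ n)) integrable_on S"
    and "(\<lambda>n. d n * integral S (\<lambda>x. f x * q x ^ n)) sums
           integral S (\<lambda>x. f x * (\<Sum>n. d n * q x ^ n))"
proof -
  let ?T = "\<lambda>N x. \<Sum>n<N. d n * (f x * q x ^ n)"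
  have int': "(\<lambda>x. f x * q x ^ n) integrable_on S" for n
    using int[of n] by (simp add: absolutely_integrable_on_def)
  have T: "?T N integrable_on S" for N
    using int' by (intro integrable_sum integrable_on_mult_right) auto
  have h: "(\<lambda>x. norm (f x) * (\<Sum>n. norm (d n))) integrable_on S"
    using int[of 0] by (intro integrable_on_mult_left) (simp add: absolutely_integrable_on_def)
  have le: "norm (?T N x) \<le> norm (f x) * (\<Sum>n. norm (d n))" if "x \<in> S" for N x
  proof -
    have "norm (?T N x) \<le> (\<Sum>n<N. norm (f x) * norm (d n))"
    proof (rule sum_norm_le)
      fix n
      have "norm (q x) ^ n \<le> 1"
        using q[OF that] by (simp add: power_le_one)
      then have "norm (f x) * norm (d n) * norm (q x) ^ n \<le> norm (f x) * norm (d n)"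
        by (intro mult_left_le) auto
      then show "norm (d n * (f x * q x ^ n)) \<le> norm (f x) * norm (d n)"
        by (simp add: norm_mult norm_power mult_ac)
    qed
    also have "\<dots> \<le> norm (f x) * (\<Sum>n. norm (d n))"
      unfolding sum_distrib_left[symmetric]
      by (intro mult_left_mono sum_le_suminf d) auto
    finally show ?thesis .
  qed
  have lim: "(\<lambda>N. ?T N x) \<longlonglongrightarrow> f x * (\<Sum>n. d n * q x ^ n)" if "x \<in> S" for x
  proof -
    have "summable (\<lambda>n. d n * q x ^ n)"
    proof (rule summable_comparison_test'[OF d])
      fix n
      have "norm (q x) ^ n \<le> 1"
        using q[OF that] by (simp add: power_le_one)
      then show "norm (d n * q x ^ n) \<le> norm (d n)"
        by (simp add: norm_mult norm_power mult_left_le)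
    qed
    then have "(\<lambda>n. f x * (d n * q x ^ n)) sums (f x * (\<Sum>n. d n * q x ^ n))"
      by (intro sums_mult summable_sums)
    then show ?thesis
      by (simp add: sums_def mult_ac)
  qed
  note dc = dominated_convergence[OF T h le lim]
  show "(\<lambda>x. f x * (\<Sum>n. d n * q x ^ n)) integrable_on S"
    by (rule dc(1))
  have "integral S (?T N) = (\<Sum>n<N. d n * integral S (\<lambda>x. f x * q x ^ n))" for N
    using int' by (simp add: integral_sum integrable_on_mult_right)
  then show "(\<lambda>n. d n * integral S (\<lambda>x. f x * q x ^ n)) sums
           integral S (\<lambda>x. f x * (\<Sum>n. d n * q x ^ n))"
    using dc(2) by (simp add: sums_def)
qed

section \<open>Growth of the reciprocal Gamma function and the k-Bessel series\<close>

lemma norm_rGamma_plus_of_nat_le: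
  fixes s :: complex
  assumes "Re s > 0"
  shows "norm (rGamma (s + of_nat n)) \<le> max (norm (rGamma s)) (norm (rGamma (s + 1)))"
proof (induction n)
  case (Suc n)
  show ?case
  \<comment> \<open>From rGamma(z) = z rGamma(z + 1), a unit shift cannot increase the norm once |z|
    is at least 1. This is guaranteed from \<open>s + 1\<close> on, but not at \<open>s\<close>,
    hence the maximum of two values.\<close>
  proof (cases "n = 0")
    case False
    let ?z = "s + of_nat n"
    have "Re ?z \<ge> 1"
      using assms False by simp
    then have "norm ?z \<ge> 1"
      using complex_Re_le_cmod order_trans by blast
    then have "1 * norm (rGamma (?z + 1)) \<le> norm ?z * norm (rGamma (?z + 1))"
      by (intro mult_right_mono) auto
    also have "\<dots> = norm (rGamma ?z)"
      using rGamma_plus1[of ?z] by (simp flip: norm_mult)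
    finally show ?thesis
      using Suc.IH by (simp add: add_ac)
  qed simp
qed simp

lemma summable_norm_rGamma_exp_series:
  fixes s x :: complex
  assumes "Re s > 0"
  shows "summable (\<lambda>n. norm (rGamma (s + of_nat n) * x ^ n / fact n))"
proof (rule summable_comparison_test')
  show "summable (\<lambda>n. max (norm (rGamma s)) (norm (rGamma (s + 1))) * norm (x ^ n /\<^sub>R fact n))"
    by (intro summable_mult summable_norm_exp)
  fix n
  have "norm (norm (rGamma (s + of_nat n) * x ^ n / fact n)) =
        norm (rGamma (s + of_nat n)) * norm (x ^ n /\<^sub>R fact n)"
    by (simp add: norm_mult norm_divide norm_inverse divide_inverse)
  also have "\<dots> \<le> max (norm (rGamma s)) (norm (rGamma (s + 1))) * norm (x ^ n /\<^sub>R fact n)"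
    by (intro mult_right_mono norm_rGamma_plus_of_nat_le assms) auto
  finally show "norm (norm (rGamma (s + of_nat n) * x ^ n / fact n)) \<le> \<dots>" .
qed

text \<open>On the principal branch a power of a product splits because one factor is a positive
  real. At \<open>x = 0\<close> the bound on \<open>Re w\<close> keeps
  \<open>2 * of_nat n + w\<close> away from 0 for positive \<open>n\<close>, so both sides vanish
  there; for \<open>n = 0\<close> the convention 0^0 = 1 makes them agree.\<close>

lemma cpow_mult_pos_real:
  assumes "r > 0" and "Re w > -1"
  shows "cpow (x * of_real r) (2 * of_nat n + w) = cpow x w * of_real r powr w * (x * of_real r) ^ (2 * n)"
proof (cases "x = 0")
  case True
  have "2 * of_nat n + w \<noteq> 0" if "n > 0"
  proof
    assume "2 * of_nat n + w = 0"
    then have "2 * real n + Re w = 0"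
      by (auto dest: arg_cong[of _ _ Re])
    with assms that show False
      by linarith
  qed
  with True assms show ?thesis
    by (cases "n = 0") (auto simp: cpow_def)
next
  case False
  have "(x * of_real r) powr (2 * of_nat n) = (x * of_real r) ^ (2 * n)"
    using False assms powr_nat'[of "x * of_real r" "2 * n"] by simp
  moreover have "(x * of_real r) powr w = x powr w * of_real r powr w"
    using assms powr_times_real_left[of "of_real r" x w] by (simp add: mult.commute)
  ultimately show ?thesis
    using False assms by (simp add: cpow_def powr_add)
qed

text \<open>Writing v = k w turns the k-gamma factor into k^(w+n) Gamma(w+1+n). Its k^n joins (-c)^n
  and (y/2)^(2n) to form the power of -c y^2 / (4k), while the powers with exponent \<open>w\<close>
  leave the sum. What remains is a power series in r^2 with coefficients independent of
  \<open>r\<close>.\<close>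

lemma k_Bessel_mult_pos_real:
  assumes k: "k > 0" and w: "Re w > -1" and r: "r > 0"
  shows "k_Bessel k (of_real k * w) c (y * of_real r) =
           cpow (y / 2) w / of_real k powr w * of_real r powr w *
           (\<Sum>n. rGamma (w + 1 + of_nat n) * (- (c * y\<^sup>2) / (4 * of_real k)) ^ n / fact n * of_real (r\<^sup>2) ^ n)"
proof -
  define X where "X = - (c * y\<^sup>2) / (4 * of_real k)"
  define K where "K = cpow (y / 2) w / of_real k powr w * of_real r powr w"
  have "(- c) ^ n / (k_Gamma k (of_nat n * of_real k + of_real k * w + of_real k) * fact n)
            * cpow (y * of_real r / 2) (2 * of_nat n + of_real k * w / of_real k) =
        K * (rGamma (w + 1 + of_nat n) * X ^ n / fact n * of_real (r\<^sup>2) ^ n)" for n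
  proof -
    define s where "s = of_nat n * of_real k + of_real k * w + of_real k"
    have s: "s / of_real k = w + 1 + of_nat n"
      using k by (simp add: s_def field_simps)
    have "Re s = k * (real n + (1 + Re w))"
      by (simp add: s_def algebra_simps)
    then have "Re s > 0"
      using k w by simp
    then have "k_Gamma k s = of_real k powr (w + of_nat n) * Gamma (w + 1 + of_nat n)"
      using k_Gamma_eq_Gamma[OF k] s by (simp add: algebra_simps)
    also have "of_real k powr (w + of_nat n) = of_real k powr w * of_real k ^ n"
      using k by (simp add: powr_add)
    finally have G: "k_Gamma k s = of_real k powr w * of_real k ^ n * Gamma (w + 1 + of_nat n)" .
    have "cpow (y / 2 * of_real r) (2 * of_nat n + w) =
          cpow (y / 2) w * of_real r powr w * ((y / 2 * of_real r)\<^sup>2) ^ n"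
      by (simp only: cpow_mult_pos_real[OF r w] power_mult)
    moreover have "X * of_real (r\<^sup>2) = - c * (y / 2 * of_real r)\<^sup>2 / of_real k"
      using k by (simp add: X_def power2_eq_square)
    then have "X ^ n * of_real (r\<^sup>2) ^ n = (- c) ^ n * ((y / 2 * of_real r)\<^sup>2) ^ n / of_real k ^ n"
      by (simp only: power_mult_distrib[of "- c"] power_divide[of _ "of_real k"]
          flip: power_mult_distrib[of X])
    moreover have "y * of_real r / 2 = y / 2 * of_real r" "of_real k * w / of_real k = w"
      using k by simp_all
    moreover have "K * (rGamma (w + 1 + of_nat n) * X ^ n / fact n * of_real (r\<^sup>2) ^ n) =
                   K * rGamma (w + 1 + of_nat n) * (X ^ n * of_real (r\<^sup>2) ^ n) / fact n"
      by simp
    ultimately show ?thesis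
      unfolding s_def[symmetric] K_def
      by (simp only: G rGamma_inverse_Gamma divide_inverse inverse_mult_distrib mult_ac)
  qed
  then have "k_Bessel k (of_real k * w) c (y * of_real r) =
      (\<Sum>n. K * (rGamma (w + 1 + of_nat n) * X ^ n / fact n * of_real (r\<^sup>2) ^ n))"
    unfolding k_Bessel_def by simp
  \<comment> \<open>Convergence justifies moving \<open>K\<close> out of the infinite sum.\<close>
  moreover have "summable (\<lambda>n. rGamma (w + 1 + of_nat n) * X ^ n / fact n * of_real (r\<^sup>2) ^ n)"
    using summable_norm_cancel[OF summable_norm_rGamma_exp_series[of "w + 1" "X * of_real (r\<^sup>2)"]] w
    by (simp add: power_mult_distrib mult.assoc)
  ultimately show ?thesis
    unfolding K_def X_def by (simp only: suminf_mult)
qed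

section \<open>Termwise evaluation of the integral and identification with the Wright series\<close>

lemma Lavoie_Trottier_integral_power_series:
  fixes d :: "nat \<Rightarrow> complex"
  assumes a: "Re a > 0" and b: "Re b > 0" and d: "summable (\<lambda>n. norm (d n))"
  defines "f \<equiv> \<lambda>x. complex_of_real x powr (a - 1) * of_real (1 - x) powr (2 * b - 1)
                     * of_real (1 - x / 3) powr (2 * a - 1) * of_real (1 - x / 4) powr (b - 1)"
  defines "F \<equiv> \<lambda>x. f x * (\<Sum>n. d n * of_real ((x * (1 - x / 3)\<^sup>2)\<^sup>2) ^ n)"
  shows "F integrable_on {0<..<1}"
    and "(\<lambda>n. (2 / 3) powr (2 * a) * Gamma b *
            (Gamma (a + 2 * of_nat n) / Gamma (a + b + 2 * of_nat n) * (16 / 81) ^ n * d n))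
           sums integral {0<..<1} F"
proof -
  define q where "q = (\<lambda>x::real. complex_of_real ((x * (1 - x / 3)\<^sup>2)\<^sup>2))"
  define f' where "f' = (\<lambda>n x. complex_of_real x powr (a + 2 * of_nat n - 1) * of_real (1 - x) powr (2 * b - 1)
      * of_real (1 - x / 3) powr (2 * (a + 2 * of_nat n) - 1) * of_real (1 - x / 4) powr (b - 1))"
  have a': "Re (a + 2 * of_nat n) > 0" for n
    using a by simp
  \<comment> \<open>The power \<open>q x ^ n\<close> contributes x^(2n) and (1 - x/3)^(4n), which is
    exactly the effect of replacing \<open>a\<close> by \<open>a + 2 * of_nat n\<close> in the
    exponents a - 1 and 2a - 1.\<close>
  have eq: "f x * q x ^ n = f' n x" if x: "x \<in> {0<..<1}" for n x
  proof -
    have pos: "0 < x" "0 < 1 - x / 3"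
      using x by auto
    have nat_powr: "of_real r powr (c + of_nat m) = of_real r powr c * complex_of_real r ^ m"
      if "r > 0" for r :: real and c m
      using that by (simp add: powr_add)
    have "of_real x powr (a + 2 * of_nat n - 1) = of_real x powr (a - 1) * complex_of_real x ^ (2 * n)"
      using nat_powr[OF pos(1), of "a - 1" "2 * n"] by (simp add: algebra_simps)
    moreover have "of_real (1 - x / 3) powr (2 * (a + 2 * of_nat n) - 1) =
                   of_real (1 - x / 3) powr (2 * a - 1) * complex_of_real (1 - x / 3) ^ (4 * n)"
      using nat_powr[OF pos(2), of "2 * a - 1" "4 * n"] by (simp add: algebra_simps)
    moreover have "q x ^ n = complex_of_real x ^ (2 * n) * complex_of_real (1 - x / 3) ^ (4 * n)"
      unfolding q_def by (simp only: of_real_mult of_real_power power_mult_distrib flip: power_mult)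
        simp
    ultimately show ?thesis
      unfolding f_def f'_def by (simp only: mult_ac)
  qed
  have int: "(\<lambda>x. f x * q x ^ n) absolutely_integrable_on {0<..<1}" for n
    using Lavoie_Trottier_integral(1)[OF a' b, of n]
    by (rule absolutely_integrable_spike[where S = "{}"]) (simp_all add: eq f'_def)
  have val: "integral {0<..<1} (\<lambda>x. f x * q x ^ n) =
             (2 / 3) powr (2 * (a + 2 * of_nat n)) * Beta (a + 2 * of_nat n) b" for n
  proof -
    have "integral {0<..<1} (\<lambda>x. f x * q x ^ n) = integral {0<..<1} (f' n)"
      by (rule integral_cong) (rule eq)
    then show ?thesis
      unfolding f'_def Lavoie_Trottier_integral(2)[OF a' b] .
  qed
  have q_le: "norm (q x) \<le> 1" if "x \<in> {0<..<1}" for x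
  proof -
    have "(1 - x / 3)\<^sup>2 \<le> 1"
      using that by (intro power_le_one) auto
    then have "x * (1 - x / 3)\<^sup>2 \<le> 1"
      using that by (intro mult_le_one) auto
    then show ?thesis
      using that unfolding q_def norm_of_real by (simp add: power_le_one)
  qed
  note series = sums_integral_power_series[OF int q_le d]
  show "F integrable_on {0<..<1}"
    unfolding F_def using series(1) by (simp add: q_def)
  have "d n * integral {0<..<1} (\<lambda>x. f x * q x ^ n) = (2 / 3) powr (2 * a) * Gamma b *
      (Gamma (a + 2 * of_nat n) / Gamma (a + b + 2 * of_nat n) * (16 / 81) ^ n * d n)" for n
  proof -
    \<comment> \<open>The shift of \<open>a\<close> by 2n produces the extra factor (2/3)^(4n) =
      (16/81)^n.\<close>
    have "(2 / 3 :: complex) powr (2 * (a + 2 * of_nat n)) = (2 / 3) powr (2 * a) * (2 / 3) powr of_nat (4 * n)"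
      by (simp add: algebra_simps flip: powr_add)
    also have "(2 / 3 :: complex) powr of_nat (4 * n) = (2 / 3) ^ (4 * n)"
      by (rule powr_nat') simp
    also have "\<dots> = (16 / 81) ^ n"
      by (simp add: power_mult power_divide)
    finally show ?thesis
      unfolding val Beta_def by (simp add: algebra_simps)
  qed
  then show "(\<lambda>n. (2 / 3) powr (2 * a) * Gamma b *
      (Gamma (a + 2 * of_nat n) / Gamma (a + b + 2 * of_nat n) * (16 / 81) ^ n * d n))
      sums integral {0<..<1} F"
    unfolding F_def using series(2) by (simp add: q_def)
qed

(* The argument of k_Bessel is y z (1 - z/3)^2.  The source prints y z (1 - z/3)^2 / 2 there, a
   misprint: with that extra factor 1/2 the identity is false, its right-hand side being the value
   of the integral without it. *)
theorem theorem2p2: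
  fixes k :: real and l \<rho> v c y :: complex
  assumes "k > 0"
    and "Re (v / of_real k) > -1"
    and "Re (l + \<rho>) > 0"
    and "Re (l + v / of_real k) > 0"
  shows "((\<lambda>z::real.
             complex_of_real z powr (l - 1)
             * complex_of_real (1 - z) powr (2 * (l + \<rho>) - 1)
             * complex_of_real (1 - z / 3) powr (2 * l - 1)
             * complex_of_real (1 - z / 4) powr ((l + \<rho>) - 1)
             * k_Bessel k v c (y * complex_of_real (z * (1 - z / 3)\<^sup>2)))
          has_integral
            (cpow (y / 2) (v / of_real k) * Gamma (l + \<rho>)
               * (2 / 3) powr (2 * (l + v / of_real k))
               / complex_of_real k powr (v / of_real k)
             * Wright_1Psi2 (l + v / of_real k, 2)
                 (v / of_real k + 1, 1) (2 * l + v / of_real k + \<rho>, 2)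
                 (- (4 * c * y\<^sup>2) / (81 * of_real k)))) {0..1}"
proof -
  define w where "w = v / of_real k"
  have v: "v = of_real k * w"
    using \<open>k > 0\<close> by (simp add: w_def)
  have w: "Re w > -1" and a: "Re (l + w) > 0" and b: "Re (l + \<rho>) > 0"
    using assms by (simp_all add: w_def)
  define X where "X = - (c * y\<^sup>2) / (4 * of_real k)"
  define d where "d = (\<lambda>n. rGamma (w + 1 + of_nat n) * X ^ n / fact n)"
  define A where "A = cpow (y / 2) w / of_real k powr w"
  define C where "C = (2 / 3) powr (2 * (l + w)) * Gamma (l + \<rho>)"
  define W where "W = Wright_1Psi2 (l + w, 2) (w + 1, 1) (2 * l + w + \<rho>, 2)
                        (- (4 * c * y\<^sup>2) / (81 * of_real k))"
  define f where "f = (\<lambda>z. complex_of_real z powr (l + w - 1) * of_real (1 - z) powr (2 * (l + \<rho>) - 1)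
      * of_real (1 - z / 3) powr (2 * (l + w) - 1) * of_real (1 - z / 4) powr ((l + \<rho>) - 1))"
  define F where "F = (\<lambda>z. f z * (\<Sum>n. d n * of_real ((z * (1 - z / 3)\<^sup>2)\<^sup>2) ^ n))"
  have d: "summable (\<lambda>n. norm (d n))"
    unfolding d_def using w by (intro summable_norm_rGamma_exp_series) simp
  have series: "F integrable_on {0<..<1}"
      "(\<lambda>n. C * (Gamma (l + w + 2 * of_nat n) / Gamma (l + w + (l + \<rho>) + 2 * of_nat n) * (16 / 81) ^ n * d n))
         sums integral {0<..<1} F"
    using Lavoie_Trottier_integral_power_series[OF a b d] by (simp_all only: F_def f_def C_def)
  \<comment> \<open>Dividing the integrated series by the nonzero \<open>C\<close> yields
    convergence of the Wright series together with its sum, with no separate convergence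
    test.\<close>
  have "C \<noteq> 0"
    using b by (simp add: C_def Gamma_nonzero_of_Re_pos)
  then have "(\<lambda>n. Gamma (l + w + 2 * of_nat n) / Gamma (l + w + (l + \<rho>) + 2 * of_nat n) * (16 / 81) ^ n * d n)
               sums (integral {0<..<1} F / C)"
    by (rule sums_mult_D[OF series(2)])
  moreover have "Gamma (l + w + 2 * of_nat n) / Gamma (l + w + (l + \<rho>) + 2 * of_nat n) * (16 / 81) ^ n * d n =
      Gamma (l + w + of_real 2 * of_nat n)
        / (Gamma (w + 1 + of_real 1 * of_nat n) * Gamma (2 * l + w + \<rho> + of_real 2 * of_nat n))
        * ((- (4 * c * y\<^sup>2) / (81 * of_real k)) ^ n / fact n)" for n
  proof -
    \<comment> \<open>The 4 in the denominator of \<open>X\<close>, coming from (y/2)^2, combines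
      with 16/81 to give 4/81.\<close>
    have "- (4 * c * y\<^sup>2) / (81 * of_real k) = 16 / 81 * X"
      by (simp add: X_def)
    then have X_power: "(- (4 * c * y\<^sup>2) / (81 * of_real k)) ^ n = (16 / 81) ^ n * X ^ n"
      by (simp only: power_mult_distrib)
    have "l + w + (l + \<rho>) + 2 * of_nat n = 2 * l + w + \<rho> + 2 * of_nat n"
      by simp
    then show ?thesis
      unfolding X_power d_def
      by (simp only: rGamma_inverse_Gamma divide_inverse inverse_mult_distrib
          of_real_1 of_real_numeral mult_1_left mult_ac)
  qed
  ultimately have "integral {0<..<1} F / C = W"
    unfolding W_def Wright_1Psi2_def by (simp add: sums_iff)
  with \<open>C \<noteq> 0\<close> have "integral {0<..<1} F = C * W"
    by (simp add: field_simps)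
  with series(1) have "(F has_integral C * W) {0<..<1}"
    by (metis integrable_integral)
  then have AF: "((\<lambda>z. A * F z) has_integral A * (C * W)) {0<..<1}"
    by (rule has_integral_mult_right)
  \<comment> \<open>The factor r^w of the Bessel function, with r = z (1 - z/3)^2, raises the
    exponent of z by w and that of 1 - z/3 by 2w. This accounts for \<open>l + w\<close> in place of
    \<open>l\<close> in \<open>f\<close>.\<close>
  have AF_eq: "A * F z = complex_of_real z powr (l - 1)
             * complex_of_real (1 - z) powr (2 * (l + \<rho>) - 1)
             * complex_of_real (1 - z / 3) powr (2 * l - 1)
             * complex_of_real (1 - z / 4) powr ((l + \<rho>) - 1)
             * k_Bessel k v c (y * complex_of_real (z * (1 - z / 3)\<^sup>2))" if z: "z \<in> {0<..<1}" for z
  proof -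
    define r where "r = z * (1 - z / 3)\<^sup>2"
    have pos: "0 < z" "0 < 1 - z / 3" "r > 0"
      using z by (auto simp: r_def)
    have "ln r = ln z + 2 * ln (1 - z / 3)"
      using pos by (simp add: r_def ln_mult ln_realpow)
    then have "of_real r powr w = of_real z powr w * complex_of_real (1 - z / 3) powr (2 * w)"
      using pos by (simp only: of_real_powr_eq_exp flip: exp_add) (simp add: algebra_simps)
    moreover have "of_real z powr (l + w - 1) = of_real z powr (l - 1) * complex_of_real z powr w"
      by (simp add: algebra_simps flip: powr_add)
    moreover have "of_real (1 - z / 3) powr (2 * (l + w) - 1) =
        of_real (1 - z / 3) powr (2 * l - 1) * complex_of_real (1 - z / 3) powr (2 * w)"
      by (simp add: algebra_simps flip: powr_add)
    moreover have "k_Bessel k v c (y * of_real r) = A * of_real r powr w * (\<Sum>n. d n * of_real (r\<^sup>2) ^ n)"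
      unfolding v A_def d_def X_def by (rule k_Bessel_mult_pos_real[OF \<open>k > 0\<close> w \<open>r > 0\<close>])
    ultimately show ?thesis
      unfolding F_def f_def r_def[symmetric] by (simp only: mult_ac)
  qed
  have "((\<lambda>z. complex_of_real z powr (l - 1)
             * complex_of_real (1 - z) powr (2 * (l + \<rho>) - 1)
             * complex_of_real (1 - z / 3) powr (2 * l - 1)
             * complex_of_real (1 - z / 4) powr ((l + \<rho>) - 1)
             * k_Bessel k v c (y * complex_of_real (z * (1 - z / 3)\<^sup>2))) has_integral A * (C * W)) {0<..<1}"
    by (rule has_integral_eq[OF AF_eq AF])
  then show ?thesis
    \<comment> \<open>Adding the two endpoints leaves the integral unchanged, whatever values the
      integrand takes there.\<close>
    unfolding has_integral_Icc_iff_Ioo w_def[symmetric] W_def[symmetric]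
    by (simp add: A_def C_def mult_ac)
qed

end
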